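(* Let $\mathcal{C}$ be the family of Borel convex subsets of $\mathbb{R}^2$. For every $\epsilon>0$ there is an $\mathcal{L}$-formula $\varphi(x,y;\overline{z},\overline{w})$ without additional parameters such that for all Borel probability measures $\mu_0,\mu_1$ on $\mathbb{R}$ and every $C\in\mathcal{C}$ there are parameters $\overline{a}\in\mathbb{R}^{|\overline{z}|+|\overline{w}|}$ with $(\mu_0\otimes\mu_1)\bigl(\varphi(\mathbb{R}^2;\overline{a})\triangle C\bigr)<\epsilon$. Moreover, there is an integer $m$ (depending only on $\epsilon$) with $|\overline{z}|=2m$ and $|\overline{w}|=m^2$ such that, given $\mu_0,\mu_1$, there is an $m\times m$ grid $\Gamma=\{(a_i,b_j):i,j<m\}\subseteq\mathbb{R}^2$ such that for every $C\in\mathcal{C}$ the defining parameters can be taken with $\overline{z}$ filled by $a_0,\dots,a_{m-1},b_0,\dots,b_{m-1}$ and $\overline{w}$ filled by elements of $\{0,1\}$.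
   Context: $\mathcal{L}=\{+,\times,-,0,1,<\}$ is the language of ordered rings, interpreted in the real field $(\mathbb{R};+,\times,-,0,1,<)$; $\varphi(\mathbb{R}^2;\overline{a})=\{(x,y)\in\mathbb{R}^2:\mathbb{R}\models\varphi(x,y;\overline{a})\}$. $\triangle$ denotes symmetric difference and $\mu_0\otimes\mu_1$ the product measure on $\mathbb{R}^2$. *)

theory Defs
  imports "HOL-Probability.Probability"
begin

(* The language of ordered rings: terms and first-order formulas over +, *, -, 0, 1, <
   (and equality).  Variables are named by natural numbers. *)

datatype or_term =
    Var nat
  | Zero
  | One
  | Add or_term or_term
  | Sub or_term or_term
  | Mul or_term or_term

datatype or_formula =
    Eq or_term or_term
  | Less or_term or_term
  | Neg or_formula
  | And or_formula or_formula
  | Or or_formula or_formula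
  | Ex nat or_formula
  | All nat or_formula

primrec term_vars :: "or_term \<Rightarrow> nat set" where
  "term_vars (Var i) = {i}"
| "term_vars Zero = {}"
| "term_vars One = {}"
| "term_vars (Add s t) = term_vars s \<union> term_vars t"
| "term_vars (Sub s t) = term_vars s \<union> term_vars t"
| "term_vars (Mul s t) = term_vars s \<union> term_vars t"

primrec free_vars :: "or_formula \<Rightarrow> nat set" where
  "free_vars (Eq s t) = term_vars s \<union> term_vars t"
| "free_vars (Less s t) = term_vars s \<union> term_vars t"
| "free_vars (Neg \<phi>) = free_vars \<phi>"
| "free_vars (And \<phi> \<psi>) = free_vars \<phi> \<union> free_vars \<psi>"
| "free_vars (Or \<phi> \<psi>) = free_vars \<phi> \<union> free_vars \<psi>"
| "free_vars (Ex i \<phi>) = free_vars \<phi> - {i}"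
| "free_vars (All i \<phi>) = free_vars \<phi> - {i}"

primrec term_val :: "(nat \<Rightarrow> real) \<Rightarrow> or_term \<Rightarrow> real" where
  "term_val e (Var i) = e i"
| "term_val e Zero = 0"
| "term_val e One = 1"
| "term_val e (Add s t) = term_val e s + term_val e t"
| "term_val e (Sub s t) = term_val e s - term_val e t"
| "term_val e (Mul s t) = term_val e s * term_val e t"

primrec sat :: "(nat \<Rightarrow> real) \<Rightarrow> or_formula \<Rightarrow> bool" where
  "sat e (Eq s t) \<longleftrightarrow> term_val e s = term_val e t"
| "sat e (Less s t) \<longleftrightarrow> term_val e s < term_val e t"
| "sat e (Neg \<phi>) \<longleftrightarrow> \<not> sat e \<phi>"
| "sat e (And \<phi> \<psi>) \<longleftrightarrow> sat e \<phi> \<and> sat e \<psi>"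
| "sat e (Or \<phi> \<psi>) \<longleftrightarrow> sat e \<phi> \<or> sat e \<psi>"
| "sat e (Ex i \<phi>) \<longleftrightarrow> (\<exists>v. sat (e(i := v)) \<phi>)"
| "sat e (All i \<phi>) \<longleftrightarrow> (\<forall>v. sat (e(i := v)) \<phi>)"

(* The variables of phi(x, y; z, w) with |z| = k, |w| = l are numbered consecutively:
   x is 0, y is 1, z is 2, ..., k + 1, and w is k + 2, ..., k + l + 1.
   No other variable may occur free, so phi has no further parameters. *)

definition formula_in :: "nat \<Rightarrow> nat \<Rightarrow> or_formula \<Rightarrow> bool" where
  "formula_in k l \<phi> \<longleftrightarrow> free_vars \<phi> \<subseteq> {..<2 + k + l}"

(* The set phi(R^2; z, w).  The default value 0 of variables beyond the list is irrelevant
   when formula_in (length zs) (length ws) phi holds. *)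

definition defined_set :: "or_formula \<Rightarrow> real list \<Rightarrow> real list \<Rightarrow> (real \<times> real) set" where
  "defined_set \<phi> zs ws =
     {(x, y). sat (\<lambda>i. if i < length (x # y # zs @ ws) then (x # y # zs @ ws) ! i else 0) \<phi>}"

definition convex_borel_sets :: "(real \<times> real) set set" where
  "convex_borel_sets = {C. C \<in> sets borel \<and> convex C}"

end

theory Submission
  imports Defs
begin

text \<open>
  Cut each axis at finitely many points, chosen among the quantiles of the marginal, so that every
  open interval between consecutive cut points has mass at most \<open>\<delta>\<close>; the cut points
  themselves are cells too, since they may be heavy atoms. A convex set is approximated by the union
  of the product cells that it contains, and the error lives on the cells that meet \<open>C\<close>
  without being contained in it. On a fixed vertical or horizontal line there are at most two of these.
  For interval times interval cells, a supporting half-plane at a point outside \<open>C\<close> shows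
  that one of the four open quadrants at that point misses \<open>C\<close>, so the bad cells split into
  four sets without strict chains (for the corresponding pair of orders). Such a set of pairs is
  the union of a partial function and the converse of one, so each carries mass at most
  \<open>2\<delta>\<close>, whatever the number of cells.
\<close>

section \<open>Masses of relations without strict chains\<close>

text \<open>When \<open>p\<close> and \<open>q\<close> give the masses of the fibers on the two
  axes, this is the sum of the product measures of the cells indexed by \<open>R\<close>.\<close>

definition mass :: "('a \<Rightarrow> real) \<Rightarrow> ('b \<Rightarrow> real) \<Rightarrow> ('a \<times> 'b) set \<Rightarrow> real" where
  "mass p q R = (\<Sum>(s, t)\<in>R. p s * q t)"

lemma mass_Un_le:
  assumes "finite R" "finite S" "\<And>s. 0 \<le> p s" "\<And>t. 0 \<le> q t"
  shows "mass p q (R \<union> S) \<le> mass p q R + mass p q S"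
proof -
  have "0 \<le> mass p q (R \<inter> S)"
    unfolding mass_def using assms by (intro sum_nonneg) auto
  then show ?thesis
    using sum.union_inter[OF assms(1,2), of "\<lambda>(s, t). p s * q t"] unfolding mass_def by linarith
qed

text \<open>Each \<open>s\<close> contributes at most one term, of size at most
  \<open>p s * \<delta>\<close>, so the number of cells does not enter the bound.\<close>

lemma mass_single_valued_le:
  assumes "R \<subseteq> S \<times> T" "finite S" "finite T" "single_valued R"
    and "\<And>s. 0 \<le> p s" "\<And>t. 0 \<le> q t" "sum p S \<le> 1" "0 \<le> \<delta>"
    and le: "\<And>s t. (s, t) \<in> R \<Longrightarrow> q t \<le> \<delta>"
  shows "mass p q R \<le> \<delta>"
proof -
  have fin: "finite R"
    using assms finite_subset by blast
  have inj: "inj_on fst R"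
    using \<open>single_valued R\<close> by (auto simp: inj_on_def single_valued_def)
  have "mass p q R \<le> (\<Sum>r\<in>R. p (fst r) * \<delta>)"
    unfolding mass_def using le assms by (intro sum_mono) (auto intro!: mult_left_mono)
  also have "\<dots> = (\<Sum>s\<in>fst ` R. p s * \<delta>)"
    using inj by (simp add: sum.reindex)
  also have "\<dots> \<le> (\<Sum>s\<in>S. p s * \<delta>)"
    using assms by (intro sum_mono2) auto
  also have "\<dots> = sum p S * \<delta>"
    by (simp add: sum_distrib_right)
  also have "\<dots> \<le> 1 * \<delta>"
    using assms by (intro mult_right_mono) auto
  finally show ?thesis by simp
qed

lemma mass_converse: "mass q p (R\<inverse>) = mass p q R"
proof -
  have "R\<inverse> = prod.swap ` R" by auto
  then show ?thesis
    by (simp add: mass_def sum.reindex case_prod_beta mult.commute)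
qed

text \<open>The entries that are \<open>\<beta>\<close>-minimal in their row form a partial
  function, and the remaining ones form the converse of one. The relations \<open>\<alpha>\<close>
  and \<open>\<beta>\<close> are parameters so that both \<open><\<close> and \<open>>\<close> can
  be inserted.\<close>

lemma mass_chain_free_le:
  assumes fin: "R \<subseteq> S \<times> T" "finite S" "finite T"
    and nonneg: "\<And>s. 0 \<le> p s" "\<And>t. 0 \<le> q t" "0 \<le> \<delta>"
    and total: "sum p S \<le> 1" "sum q T \<le> 1"
    and small: "\<And>s t. (s, t) \<in> R \<Longrightarrow> p s \<le> \<delta> \<and> q t \<le> \<delta>"
    and \<alpha>: "\<And>s s'. s \<noteq> s' \<Longrightarrow> \<alpha> s s' \<or> \<alpha> s' s"
    and \<beta>: "\<And>t t'. t \<noteq> t' \<Longrightarrow> \<beta> t t' \<or> \<beta> t' t"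
    and chain_free: "\<And>s t s' t'. (s, t) \<in> R \<Longrightarrow> (s', t') \<in> R \<Longrightarrow> \<alpha> s s' \<Longrightarrow> \<beta> t t' \<Longrightarrow> False"
  shows "mass p q R \<le> 2 * \<delta>"
proof -
  define R1 where "R1 = {(s, t) \<in> R. \<forall>t'. (s, t') \<in> R \<longrightarrow> \<not> \<beta> t' t}"
  have R1: "R1 \<subseteq> R" by (auto simp: R1_def)
  have sv1: "single_valued R1"
    using \<beta> unfolding single_valued_def R1_def by blast
  have sv2: "single_valued ((R - R1)\<inverse>)"
  proof (rule single_valuedI)
    fix t s s' assume "(t, s) \<in> (R - R1)\<inverse>" "(t, s') \<in> (R - R1)\<inverse>"
    then obtain u u' where "(s, u) \<in> R" "\<beta> u t" "(s', u') \<in> R" "\<beta> u' t" "(s, t) \<in> R" "(s', t) \<in> R"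
      unfolding R1_def by auto
    \<comment> \<open>If \<open>\<alpha> s s'\<close>, then \<open>(s, u)\<close> and
      \<open>(s', t)\<close> form a chain because \<open>\<beta> u t\<close>; if
      \<open>\<alpha> s' s\<close>, then \<open>(s', u')\<close> and \<open>(s, t)\<close>
      do.\<close>
    then show "s = s'"
      using \<alpha>[of s s'] chain_free by blast
  qed
  have "finite R"
    using fin finite_subset by blast
  then have "mass p q R \<le> mass p q R1 + mass p q (R - R1)"
    using mass_Un_le[of R1 "R - R1" p q] nonneg R1 finite_subset[OF R1]
    by (simp add: Un_absorb1)
  moreover have "mass p q R1 \<le> \<delta>"
    by (rule mass_single_valued_le[OF order_trans[OF R1 fin(1)] fin(2,3) sv1 nonneg(1,2) total(1) nonneg(3)])
      (use R1 small in blast)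
  moreover have "mass q p ((R - R1)\<inverse>) \<le> \<delta>"
    using fin small by (intro mass_single_valued_le[OF _ fin(3,2) sv2 nonneg(2,1) total(2) nonneg(3)]) blast+
  ultimately show ?thesis
    by (simp add: mass_converse)
qed

text \<open>Since a row has at most two entries, the least entries form one partial function and the
  other entries a second one.\<close>

lemma mass_at_most_two_le:
  fixes R :: "('a \<times> 'b::linorder) set"
  assumes fin: "R \<subseteq> S \<times> T" "finite S" "finite T"
    and nonneg: "\<And>s. 0 \<le> p s" "\<And>t. 0 \<le> q t" "0 \<le> \<delta>"
    and total: "sum p S \<le> 1"
    and small: "\<And>s t. (s, t) \<in> R \<Longrightarrow> q t \<le> \<delta>"
    and two: "\<And>s t t' t''. (s, t) \<in> R \<Longrightarrow> (s, t') \<in> R \<Longrightarrow> (s, t'') \<in> R \<Longrightarrow> t < t' \<Longrightarrow> t' < t'' \<Longrightarrow> False"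
  shows "mass p q R \<le> 2 * \<delta>"
proof -
  define R1 where "R1 = {(s, t) \<in> R. \<forall>t'. (s, t') \<in> R \<longrightarrow> \<not> t' < t}"
  have R1: "R1 \<subseteq> R" by (auto simp: R1_def)
  have sv1: "single_valued R1"
    unfolding single_valued_def R1_def by (auto intro: antisym simp: not_less)
  have sv2: "single_valued (R - R1)"
  proof (rule single_valuedI)
    fix s t t' assume "(s, t) \<in> R - R1" "(s, t') \<in> R - R1"
    then obtain u u' where "(s, u) \<in> R" "u < t" "(s, u') \<in> R" "u' < t'" "(s, t) \<in> R" "(s, t') \<in> R"
      unfolding R1_def by blast
    \<comment> \<open>If \<open>t < t'\<close>, then \<open>u < t < t'\<close> are three entries of
      row \<open>s\<close>; if \<open>t' < t\<close>, then \<open>u' < t' < t\<close> are.\<close>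
    then show "t = t'"
      using two by (meson linorder_neqE)
  qed
  have "finite R"
    using fin finite_subset by blast
  then have "mass p q R \<le> mass p q R1 + mass p q (R - R1)"
    using mass_Un_le[of R1 "R - R1" p q] nonneg R1 finite_subset[OF R1]
    by (simp add: Un_absorb1)
  moreover have "mass p q R1 \<le> \<delta>"
    by (rule mass_single_valued_le[OF order_trans[OF R1 fin(1)] fin(2,3) sv1 nonneg(1,2) total nonneg(3)])
      (use R1 small in blast)
  moreover have "mass p q (R - R1) \<le> \<delta>"
    using fin small by (intro mass_single_valued_le[OF _ fin(2,3) sv2 nonneg(1,2) total nonneg(3)]) blast+
  ultimately show ?thesis
    by simp
qed

section \<open>Approximation of planar convex sets by unions of cells\<close>

text \<open>Let the functional \<open>(c, d)\<close> separate \<open>C\<close> weakly from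
  \<open>u\<close>. On the open quadrant at \<open>u\<close> selected by the signs of
  \<open>c\<close> and \<open>d\<close> it is strictly larger than at \<open>u\<close>, so this
  quadrant misses \<open>C\<close>.\<close>

lemma convex_quadrant_disjoint:
  fixes C :: "(real \<times> real) set"
  assumes "convex C" "u \<notin> C"
  obtains "\<And>v. v \<in> C \<Longrightarrow> fst u < fst v \<Longrightarrow> snd u < snd v \<Longrightarrow> False"
    | "\<And>v. v \<in> C \<Longrightarrow> fst u < fst v \<Longrightarrow> snd u > snd v \<Longrightarrow> False"
    | "\<And>v. v \<in> C \<Longrightarrow> fst u > fst v \<Longrightarrow> snd u < snd v \<Longrightarrow> False"
    | "\<And>v. v \<in> C \<Longrightarrow> fst u > fst v \<Longrightarrow> snd u > snd v \<Longrightarrow> False"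
proof (cases "C = {}")
  case True
  then show thesis using that(1) by blast
next
  case False
  have "\<exists>a b. a \<noteq> 0 \<and> (\<forall>x\<in>C. inner a x \<le> b) \<and> (\<forall>x\<in>{u}. inner a x \<ge> b)"
    using assms False by (intro separating_hyperplane_sets) auto
  then obtain a where "a \<noteq> 0" and le: "\<And>x. x \<in> C \<Longrightarrow> inner a x \<le> inner a u"
    by fastforce
  obtain c d where a: "a = (c, d)" by force
  then have nz: "c \<noteq> 0 \<or> d \<noteq> 0"
    using \<open>a \<noteq> 0\<close> by (auto simp: zero_prod_def)
  have le': "c * (fst v - fst u) + d * (snd v - snd u) \<le> 0" if "v \<in> C" for v
    using le[OF that] by (cases u; cases v) (simp add: a algebra_simps)
  \<comment> \<open>One of \<open>c\<close> and \<open>d\<close> may vanish. Openness of the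
    quadrant makes \<open>x\<close> and \<open>y\<close> both nonzero, so a nonzero coefficient
    still gives a strictly positive term.\<close>
  have pos: "0 < c * x + d * y" if "0 \<le> c * x" "0 \<le> d * y" "x \<noteq> 0" "y \<noteq> 0" for x y
    using that nz by (metis add_nonneg_pos add_pos_nonneg less_eq_real_def mult_eq_0_iff)
  have no: False if "v \<in> C" "0 \<le> c * (fst v - fst u)" "0 \<le> d * (snd v - snd u)"
      "fst v \<noteq> fst u" "snd v \<noteq> snd u" for v
    using pos[OF that(2,3)] le'[OF that(1)] that(4,5) by auto
  consider "0 \<le> c" "0 \<le> d" | "0 \<le> c" "d \<le> 0" | "c \<le> 0" "0 \<le> d" | "c \<le> 0" "d \<le> 0"
    by linarith
  then show thesis
  proof cases
    case 1 then show thesis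
      by (intro that(1)) (rule no, auto simp: zero_le_mult_iff)
  next
    case 2 then show thesis
      by (intro that(2)) (rule no, auto simp: zero_le_mult_iff)
  next
    case 3 then show thesis
      by (intro that(3)) (rule no, auto simp: zero_le_mult_iff)
  next
    case 4 then show thesis
      by (intro that(4)) (rule no, auto simp: zero_le_mult_iff)
  qed
qed

text \<open>The slice of \<open>C\<close> over \<open>x\<close> is convex, hence an
  interval.\<close>

lemma convex_vertical_line:
  fixes C :: "(real \<times> real) set"
  assumes "convex C" "(x, y) \<in> C" "(x, y'') \<in> C" "y < y'" "y' < y''"
  shows "(x, y') \<in> C"
proof -
  have "convex (Pair x -` C)"
  proof (rule convexI)
    fix r s u v :: real
    assume "r \<in> Pair x -` C" "s \<in> Pair x -` C" "0 \<le> u" "0 \<le> v" "u + v = 1"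
    then have "u *\<^sub>R (x, r) + v *\<^sub>R (x, s) \<in> C"
      using convexD[OF \<open>convex C\<close>] by auto
    moreover have "u * x + v * x = x"
      using \<open>u + v = 1\<close> by (metis distrib_right mult_1)
    ultimately show "u *\<^sub>R r + v *\<^sub>R s \<in> Pair x -` C"
      by simp
  qed
  then have "is_interval (Pair x -` C)"
    by (simp add: is_interval_convex_1)
  then show ?thesis
    using assms(2-5) mem_is_interval_1_I[of "Pair x -` C" y y'' y'] by auto
qed

lemma convex_swap:
  fixes C :: "('a::real_vector \<times> 'b::real_vector) set"
  shows "convex C \<Longrightarrow> convex (prod.swap ` C)"
  by (rule convex_linear_image) (auto simp: linear_iff)

section \<open>Fibers of monotone labellings of the line\<close>

lemma mono_nat_fiber_borel:
  fixes f :: "real \<Rightarrow> nat"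
  assumes "mono f"
  shows "f -` {s} \<in> sets borel"
proof -
  \<comment> \<open>Labels are embedded in the reals so that Borel measurability of monotone real
    functions applies.\<close>
  have "mono (\<lambda>x. real (f x))"
    using assms by (auto simp: mono_def)
  then have "(\<lambda>x. real (f x)) -` {real s} \<inter> space borel \<in> sets borel"
    by (intro measurable_sets[OF borel_measurable_mono]) auto
  then show ?thesis
    by (simp add: vimage_def)
qed

lemma mono_less_imp_less:
  fixes f :: "real \<Rightarrow> nat"
  shows "mono f \<Longrightarrow> f x < f y \<Longrightarrow> x < y"
  by (meson monoD not_le)

lemma sum_fiber_measure_le:
  fixes f :: "real \<Rightarrow> nat"
  assumes "real_distribution M" "mono f"
  shows "(\<Sum>s<m. measure M (f -` {s})) \<le> 1"
proof -
  interpret real_distribution M by fact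
  have "(\<Sum>s<m. prob (f -` {s})) = prob (\<Union>s<m. f -` {s})"
    using mono_nat_fiber_borel[OF \<open>mono f\<close>]
    by (intro finite_measure_finite_Union[symmetric]) (auto simp: disjoint_family_on_def)
  then show ?thesis by simp
qed

section \<open>Mass of the cells cut by a convex set\<close>

text \<open>Cells are named by their pairs of labels, so that the bounds on masses of relations
  apply to them.\<close>

definition bad_cells :: "(real \<Rightarrow> nat) \<Rightarrow> (real \<Rightarrow> nat) \<Rightarrow> (real \<times> real) set \<Rightarrow> (nat \<times> nat) set" where
  "bad_cells f g C = {(s, t). (\<exists>x y. f x = s \<and> g y = t \<and> (x, y) \<in> C) \<and>
     (\<exists>x y. f x = s \<and> g y = t \<and> (x, y) \<notin> C)}"

lemma bad_cells_swap: "bad_cells g f (prod.swap ` C) = (bad_cells f g C)\<inverse>"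
proof -
  have "(y, x) \<in> prod.swap ` C \<longleftrightarrow> (x, y) \<in> C" for x y
    by force
  then show ?thesis
    unfolding bad_cells_def by auto
qed

text \<open>Here every cell of \<open>R\<close> lies on a vertical line. Of three such cells above
  each other, the outer two would contain points of \<open>C\<close> and the middle one a point
  outside \<open>C\<close>, against convexity; hence at most two occur per line.\<close>

lemma mass_bad_cells_line_le:
  assumes mono: "mono g" and C: "convex C"
    and fin: "R \<subseteq> bad_cells f g C" "R \<subseteq> {..<m} \<times> {..<m}"
    and nonneg: "\<And>s. 0 \<le> p s" "\<And>t. 0 \<le> q t" "0 \<le> \<delta>"
    and total: "sum p {..<m} \<le> 1"
    and cell: "\<And>s t. (s, t) \<in> R \<Longrightarrow> q t \<le> \<delta> \<and> (\<exists>a. f -` {s} \<subseteq> {a})"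
  shows "mass p q R \<le> 2 * \<delta>"
proof (rule mass_at_most_two_le[OF fin(2) _ _ nonneg total])
  fix s t t' t'' :: nat
  assume R: "(s, t) \<in> R" "(s, t') \<in> R" "(s, t'') \<in> R" and less: "t < t'" "t' < t''"
  obtain a where a: "\<And>x. f x = s \<Longrightarrow> x = a"
    using cell[OF R(1)] by auto
  obtain y where y: "g y = t" "(a, y) \<in> C"
    using R(1) fin(1) a unfolding bad_cells_def by blast
  obtain y' where y': "g y' = t'" "(a, y') \<notin> C"
    using R(2) fin(1) a unfolding bad_cells_def by blast
  obtain y'' where y'': "g y'' = t''" "(a, y'') \<in> C"
    using R(3) fin(1) a unfolding bad_cells_def by blast
  show False
    using convex_vertical_line[OF C, of a y y'' y'] y y' y'' less mono_less_imp_less[OF mono] by blast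
qed (use cell in auto)

text \<open>In a chain, the second cell contains a point of \<open>C\<close>, and comparing labels
  places this point in the quadrant at the point \<open>u\<close> of the first cell, which misses
  \<open>C\<close>. So \<open>R\<close> is free of chains. The primed relations compare coordinates,
  the unprimed ones labels.\<close>

lemma mass_bad_cells_quadrant_le:
  fixes \<alpha> \<beta> :: "nat \<Rightarrow> nat \<Rightarrow> bool" and \<alpha>' \<beta>' :: "real \<Rightarrow> real \<Rightarrow> bool"
  assumes fin: "R \<subseteq> bad_cells f g C" "R \<subseteq> {..<m} \<times> {..<m}"
    and nonneg: "\<And>s. 0 \<le> p s" "\<And>t. 0 \<le> q t" "0 \<le> \<delta>"
    and total: "sum p {..<m} \<le> 1" "sum q {..<m} \<le> 1"
    and small: "\<And>s t. (s, t) \<in> R \<Longrightarrow> p s \<le> \<delta> \<and> q t \<le> \<delta>"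
    and \<alpha>: "\<And>s s'. s \<noteq> s' \<Longrightarrow> \<alpha> s s' \<or> \<alpha> s' s" "\<And>x x'. \<alpha> (f x) (f x') \<Longrightarrow> \<alpha>' x x'"
    and \<beta>: "\<And>t t'. t \<noteq> t' \<Longrightarrow> \<beta> t t' \<or> \<beta> t' t" "\<And>y y'. \<beta> (g y) (g y') \<Longrightarrow> \<beta>' y y'"
    and quadrant: "\<And>s t. (s, t) \<in> R \<Longrightarrow>
      \<exists>u. f (fst u) = s \<and> g (snd u) = t \<and> (\<forall>v\<in>C. \<not> (\<alpha>' (fst u) (fst v) \<and> \<beta>' (snd u) (snd v)))"
  shows "mass p q R \<le> 2 * \<delta>"
proof (rule mass_chain_free_le[OF fin(2) _ _ nonneg total small \<alpha>(1) \<beta>(1)])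
  fix s t s' t'
  assume R: "(s, t) \<in> R" "(s', t') \<in> R" and less: "\<alpha> s s'" "\<beta> t t'"
  obtain u where u: "f (fst u) = s" "g (snd u) = t"
    "\<forall>v\<in>C. \<not> (\<alpha>' (fst u) (fst v) \<and> \<beta>' (snd u) (snd v))"
    using quadrant[OF R(1)] by blast
  obtain x y where "f x = s'" "g y = t'" "(x, y) \<in> C"
    using R(2) fin(1) unfolding bad_cells_def by blast
  then show False
    using u less \<alpha>(2)[of "fst u" x] \<beta>(2)[of "snd u" y] by force
qed auto

text \<open>The constant 12 is twice six: one class of cells on vertical lines, one on horizontal
  lines, and one for each of the four quadrants. The classes may overlap, since mass is
  subadditive.\<close>

lemma mass_bad_cells_le:
  assumes mono: "mono f" "mono g" and C: "convex C"
    and range: "\<And>x. f x < m" "\<And>y. g y < m"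
    and nonneg: "\<And>s. 0 \<le> p s" "\<And>t. 0 \<le> q t" "0 \<le> \<delta>"
    and total: "sum p {..<m} \<le> 1" "sum q {..<m} \<le> 1"
    and f: "\<And>s. p s \<le> \<delta> \<or> (\<exists>a. f -` {s} \<subseteq> {a})"
    and g: "\<And>t. q t \<le> \<delta> \<or> (\<exists>a. g -` {t} \<subseteq> {a})"
  shows "mass p q (bad_cells f g C) \<le> 12 * \<delta>"
proof -
  let ?B = "bad_cells f g C"
  have sub: "?B \<subseteq> {..<m} \<times> {..<m}"
    using range by (auto simp: bad_cells_def)
  define V where "V = {(s, t) \<in> ?B. q t \<le> \<delta> \<and> (\<exists>a. f -` {s} \<subseteq> {a})}"
  define H where "H = {(s, t) \<in> ?B. p s \<le> \<delta> \<and> (\<exists>a. g -` {t} \<subseteq> {a})}"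
  define Q :: "(real \<Rightarrow> real \<Rightarrow> bool) \<Rightarrow> (real \<Rightarrow> real \<Rightarrow> bool) \<Rightarrow> (nat \<times> nat) set" where
    "Q \<alpha> \<beta> = {(s, t) \<in> ?B. p s \<le> \<delta> \<and> q t \<le> \<delta> \<and>
      (\<exists>u. f (fst u) = s \<and> g (snd u) = t \<and> (\<forall>v\<in>C. \<not> (\<alpha> (fst u) (fst v) \<and> \<beta> (snd u) (snd v))))}"
    for \<alpha> \<beta>
  have subs: "V \<subseteq> ?B" "H \<subseteq> ?B" "Q \<alpha> \<beta> \<subseteq> ?B" for \<alpha> \<beta>
    by (auto simp: V_def H_def Q_def)
  have fin: "finite V" "finite H" "finite (Q \<alpha> \<beta>)" for \<alpha> \<beta>
    using subs sub by (meson finite_SigmaI finite_lessThan finite_subset)+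
  have V: "mass p q V \<le> 2 * \<delta>"
    using subs sub by (intro mass_bad_cells_line_le[OF mono(2) C _ _ nonneg total(1)])
      (auto simp: V_def)
  \<comment> \<open>Exchanging the axes turns horizontal lines into vertical ones.\<close>
  have "mass q p (H\<inverse>) \<le> 2 * \<delta>"
    using subs(2) sub
    by (intro mass_bad_cells_line_le[OF mono(1) convex_swap[OF C], of _ g m])
      (auto simp: bad_cells_swap nonneg total H_def)
  then have H: "mass p q H \<le> 2 * \<delta>"
    by (simp add: mass_converse)
  have Q_le: "mass p q (Q \<alpha>' \<beta>') \<le> 2 * \<delta>"
    if "\<And>s s'. s \<noteq> s' \<Longrightarrow> \<alpha> s s' \<or> \<alpha> s' s" "\<And>x x'. \<alpha> (f x) (f x') \<Longrightarrow> \<alpha>' x x'"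
      "\<And>t t'. t \<noteq> t' \<Longrightarrow> \<beta> t t' \<or> \<beta> t' t" "\<And>y y'. \<beta> (g y) (g y') \<Longrightarrow> \<beta>' y y'"
    for \<alpha> \<beta> :: "nat \<Rightarrow> nat \<Rightarrow> bool" and \<alpha>' \<beta>'
    by (rule mass_bad_cells_quadrant_le[where \<alpha>' = \<alpha>' and \<beta>' = \<beta>',
        OF subs(3) subset_trans[OF subs(3) sub] nonneg total _ that])
      (auto simp: Q_def)
  note less = mono_less_imp_less[OF mono(1)] mono_less_imp_less[OF mono(2)]
  have Q1: "mass p q (Q (<) (<)) \<le> 2 * \<delta>"
    by (rule Q_le[of "(<)" "(<)" "(<)" "(<)"]) (auto dest: less)
  have Q2: "mass p q (Q (<) (>)) \<le> 2 * \<delta>"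
    by (rule Q_le[of "(<)" "(<)" "(>)" "(>)"]) (auto dest: less)
  have Q3: "mass p q (Q (>) (<)) \<le> 2 * \<delta>"
    by (rule Q_le[of "(>)" "(>)" "(<)" "(<)"]) (auto dest: less)
  have Q4: "mass p q (Q (>) (>)) \<le> 2 * \<delta>"
    by (rule Q_le[of "(>)" "(>)" "(>)" "(>)"]) (auto dest: less)
  have cover: "?B \<subseteq> V \<union> (H \<union> (Q (<) (<) \<union> (Q (<) (>) \<union> (Q (>) (<) \<union> Q (>) (>)))))"
  proof
    fix r assume "r \<in> ?B"
    then obtain s t x y x' y' where r: "r = (s, t)" "(s, t) \<in> ?B" "f x = s" "g y = t" "(x, y) \<in> C"
      and u: "f x' = s" "g y' = t" "(x', y') \<notin> C"
      unfolding bad_cells_def by blast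
    have "\<not> ((\<exists>a. f -` {s} \<subseteq> {a}) \<and> (\<exists>a. g -` {t} \<subseteq> {a}))"
    proof
      assume "(\<exists>a. f -` {s} \<subseteq> {a}) \<and> (\<exists>a. g -` {t} \<subseteq> {a})"
      then obtain a b where "f -` {s} \<subseteq> {a}" "g -` {t} \<subseteq> {b}" by blast
      then have "x = a" "x' = a" "y = b" "y' = b"
        using r(3,4) u(1,2) by blast+
      then show False using r(5) u(3) by blast
    qed
    \<comment> \<open>A cell with two one-point sides is a single point and cannot be bad, so at
      most one side is heavy, and then the heavy side is a single point.\<close>
    then consider "p s \<le> \<delta>" "q t \<le> \<delta>" | "p s \<le> \<delta>" "\<exists>a. g -` {t} \<subseteq> {a}"
      | "q t \<le> \<delta>" "\<exists>a. f -` {s} \<subseteq> {a}"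
      using f[of s] g[of t] by blast
    then show "r \<in> V \<union> (H \<union> (Q (<) (<) \<union> (Q (<) (>) \<union> (Q (>) (<) \<union> Q (>) (>)))))"
    proof cases
      case 1
      \<comment> \<open>The apex of the quadrant is the point \<open>(x', y')\<close> of the cell
        that lies outside \<open>C\<close>.\<close>
      have mem: "(s, t) \<in> Q \<alpha> \<beta>"
        if "\<And>v. v \<in> C \<Longrightarrow> \<alpha> (fst (x', y')) (fst v) \<Longrightarrow> \<beta> (snd (x', y')) (snd v) \<Longrightarrow> False"
        for \<alpha> \<beta>
        using that r(2) 1 u unfolding Q_def by fastforce
      show ?thesis
        using C u(3)
      proof (cases rule: convex_quadrant_disjoint)
        case 1
        then have "(s, t) \<in> Q (<) (<)" by (rule mem)
        then show ?thesis using r(1) by blast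
      next
        case 2
        then have "(s, t) \<in> Q (<) (>)" by (rule mem)
        then show ?thesis using r(1) by blast
      next
        case 3
        then have "(s, t) \<in> Q (>) (<)" by (rule mem)
        then show ?thesis using r(1) by blast
      next
        case 4
        then have "(s, t) \<in> Q (>) (>)" by (rule mem)
        then show ?thesis using r(1) by blast
      qed
    qed (use r in \<open>auto simp: V_def H_def\<close>)
  qed
  have eq: "?B = V \<union> (H \<union> (Q (<) (<) \<union> (Q (<) (>) \<union> (Q (>) (<) \<union> Q (>) (>)))))"
    using cover subs by blast
  note Un = mass_Un_le[where p = p and q = q, OF _ _ nonneg(1,2)]
  show ?thesis
    unfolding eq
    using V H Q1 Q2 Q3 Q4
      Un[of V "H \<union> (Q (<) (<) \<union> (Q (<) (>) \<union> (Q (>) (<) \<union> Q (>) (>))))"]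
      Un[of H "Q (<) (<) \<union> (Q (<) (>) \<union> (Q (>) (<) \<union> Q (>) (>)))"]
      Un[of "Q (<) (<)" "Q (<) (>) \<union> (Q (>) (<) \<union> Q (>) (>))"]
      Un[of "Q (<) (>)" "Q (>) (<) \<union> Q (>) (>)"]
      Un[of "Q (>) (<)" "Q (>) (>)"] fin
    by simp
qed

text \<open>A point of the symmetric difference lies in \<open>C\<close> while its cell is not
  contained in \<open>C\<close>, so the error is covered by the bad cells, whose product measures
  add up to their \<open>mass\<close>.\<close>

lemma convex_cell_approximation:
  fixes f g :: "real \<Rightarrow> nat"
  assumes M: "real_distribution M" "real_distribution N"
    and mono: "mono f" "mono g" and C: "convex C"
    and range: "\<And>x. f x < m" "\<And>y. g y < m" and "0 \<le> \<delta>"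
    and f: "\<And>s. measure M (f -` {s}) \<le> \<delta> \<or> (\<exists>a. f -` {s} \<subseteq> {a})"
    and g: "\<And>t. measure N (g -` {t}) \<le> \<delta> \<or> (\<exists>a. g -` {t} \<subseteq> {a})"
  shows "measure (M \<Otimes>\<^sub>M N)
    (sym_diff {(x, y). f -` {f x} \<times> g -` {g y} \<subseteq> C} C) \<le> 12 * \<delta>"
proof -
  interpret M: real_distribution M by fact
  interpret N: real_distribution N by fact
  interpret P: pair_prob_space M N ..
  let ?B = "bad_cells f g C" and ?cell = "\<lambda>(s, t). f -` {s} \<times> g -` {t}"
  let ?D = "{(x, y). f -` {f x} \<times> g -` {g y} \<subseteq> C}"
  have "?B \<subseteq> {..<m} \<times> {..<m}"
    using range by (auto simp: bad_cells_def)
  then have fin: "finite ?B"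
    using finite_subset by blast
  have cell: "?cell r \<in> sets (M \<Otimes>\<^sub>M N)" for r
    using mono_nat_fiber_borel[OF mono(1)] mono_nat_fiber_borel[OF mono(2)]
    by (auto split: prod.split)
  have "sym_diff ?D C \<subseteq> (\<Union>r\<in>?B. ?cell r)"
    by (fastforce simp: bad_cells_def)
  then have "measure (M \<Otimes>\<^sub>M N) (sym_diff ?D C) \<le> measure (M \<Otimes>\<^sub>M N) (\<Union>r\<in>?B. ?cell r)"
    using fin cell by (intro P.finite_measure_mono) auto
  also have "\<dots> \<le> (\<Sum>r\<in>?B. measure (M \<Otimes>\<^sub>M N) (?cell r))"
    using fin cell by (intro P.finite_measure_subadditive_finite) auto
  also have "\<dots> = mass (\<lambda>s. measure M (f -` {s})) (\<lambda>t. measure N (g -` {t})) ?B"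
    unfolding mass_def
    using mono_nat_fiber_borel[OF mono(1)] mono_nat_fiber_borel[OF mono(2)]
    by (intro sum.cong)
      (auto simp: measure_def N.emeasure_pair_measure_Times enn2real_mult)
  also have "\<dots> \<le> 12 * \<delta>"
    using assms sum_fiber_measure_le by (intro mass_bad_cells_le[of f g C m]) auto
  finally show ?thesis .
qed

section \<open>Quantiles and ranks\<close>

text \<open>The cut points are the values of the generalized inverse \<open>I\<close> of the
  distribution function at the levels \<open>k / N\<close>. The open interval between consecutive
  quantiles has mass at most \<open>1 / N\<close>, however heavy the atoms at its ends are.\<close>

lemma quantile_cut_points:
  assumes "real_distribution M" "0 < N"
  obtains A where "finite A" "card A \<le> N"
    "\<And>S. is_interval S \<Longrightarrow> S \<in> sets borel \<Longrightarrow> S \<inter> A = {} \<Longrightarrow> measure M S \<le> 1 / N"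
proof -
  interpret real_distribution M by fact
  interpret cdf_distribution M ..
  \<comment> \<open>The levels 0 and 1 are left out because \<open>I\<close> inverts the
    distribution function only at levels strictly between them.\<close>
  have I: "real k / N \<le> cdf M x \<longleftrightarrow> I (real k / N) \<le> x" if "0 < k" "k < N" for k x
    using that by (intro pseudoinverse) auto
  define A where "A = (\<lambda>k. I (real k / N)) ` {0<..<N}"
  have "card A \<le> card {0<..<N}"
    unfolding A_def by (intro card_image_le) simp
  moreover have "measure M S \<le> 1 / N"
    if S: "is_interval S" "S \<in> sets borel" "S \<inter> A = {}" for S
  proof (cases "S = {}")
    case False
    then obtain x where x: "x \<in> S" by auto
    \<comment> \<open>The last level reached at \<open>x\<close>. The bound \<open>k < N\<close>
      puts points where the distribution function equals 1 into the last gap.\<close>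
    define k where "k = Max {k. k < N \<and> real k / N \<le> cdf M x}"
    have K: "finite {k. k < N \<and> real k / N \<le> cdf M x}" "0 \<in> {k. k < N \<and> real k / N \<le> cdf M x}"
      using \<open>0 < N\<close> by (auto simp: cdf_nonneg)
    then have "k \<in> {k. k < N \<and> real k / N \<le> cdf M x}"
      unfolding k_def by (intro Max_in) auto
    then have k: "k < N" "real k / N \<le> cdf M x" by auto
    have k': "cdf M x < real (Suc k) / N" if "Suc k < N"
    proof (rule ccontr)
      assume "\<not> cdf M x < real (Suc k) / N"
      then have "Suc k \<le> k"
        using K that unfolding k_def by (intro Max_ge) auto
      then show False by simp
    qed
    \<comment> \<open>The set \<open>S\<close> will be enclosed in \<open>U - L\<close>, which
      contains neither of the two neighbouring quantiles. In the outermost gaps a quantile is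
      missing, and the empty set or the whole line replaces its half-line.\<close>
    define L where "L = (if k = 0 then {} else {..I (real k / N)})"
    define U where "U = (if Suc k < N then {..<I (real (Suc k) / N)} else UNIV)"
    have L: "real k / N \<le> measure M L"
      using I[of k "I (real k / N)"] k by (auto simp: L_def cdf_def)
    have U: "measure M U \<le> real (Suc k) / N"
    proof (cases "Suc k < N")
      case True
      \<comment> \<open>The mass of the open half-line is the left limit of the distribution
        function, so the bound strictly before the quantile passes to it.\<close>
      have "cdf M z \<le> real (Suc k) / N" if "z < I (real (Suc k) / N)" for z
        using I[of "Suc k" z] True that by linarith
      then have "\<forall>\<^sub>F z in at_left (I (real (Suc k) / N)). cdf M z \<le> real (Suc k) / N"
        by (auto simp: eventually_at_filter)
      then have "measure M {..<I (real (Suc k) / N)} \<le> real (Suc k) / N"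
        by (intro tendsto_upperbound[OF cdf_at_left]) auto
      then show ?thesis using True by (simp add: U_def)
    next
      case False
      then have "1 \<le> real (Suc k) / N"
        using \<open>0 < N\<close> by (simp add: field_simps)
      then show ?thesis
        using prob_le_1[of U] by linarith
    qed
    have "S \<subseteq> U - L"
    proof
      fix y assume y: "y \<in> S"
      \<comment> \<open>An interval that contains \<open>x\<close> and a point beyond a neighbouring
        quantile would contain the quantile itself, which is excluded.\<close>
      have out: "I (real j / N) \<notin> S" if "0 < j" "j < N" for j
        using that S(3) unfolding A_def by auto
      have "y \<notin> L"
      proof
        assume "y \<in> L"
        then have "0 < k" "y \<le> I (real k / N)" by (auto simp: L_def split: if_splits)
        moreover have "I (real k / N) \<le> x" using I k \<open>0 < k\<close> by blast
        ultimately show False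
          using out[OF _ k(1)] mem_is_interval_1_I[OF S(1) y x] by blast
      qed
      moreover have "y \<in> U"
      proof (rule ccontr)
        assume "y \<notin> U"
        then have *: "Suc k < N" "I (real (Suc k) / N) \<le> y" by (auto simp: U_def split: if_splits)
        moreover have "x \<le> I (real (Suc k) / N)" using I[of "Suc k" x] k' * by linarith
        ultimately show False
          using out[of "Suc k"] mem_is_interval_1_I[OF S(1) x y] by blast
      qed
      ultimately show "y \<in> U - L" by blast
    qed
    then have "measure M S \<le> measure M (U - L)"
      by (intro finite_measure_mono) (auto simp: U_def L_def)
    also have "\<dots> = measure M U - measure M L"
    proof (rule finite_measure_Diff)
      show "L \<subseteq> U"
      proof (cases "k \<noteq> 0 \<and> Suc k < N")
        case True
        then have "I (real k / N) \<le> x" "x < I (real (Suc k) / N)"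
          using I[of k x] I[of "Suc k" x] k k' by auto
        then show ?thesis by (auto simp: L_def U_def)
      qed (auto simp: L_def U_def)
    qed (auto simp: L_def U_def)
    also have "\<dots> \<le> real (Suc k) / N - real k / N"
      using L U by linarith
    also have "\<dots> = 1 / N"
      by (simp add: diff_divide_distrib[symmetric])
    finally show ?thesis .
  qed simp
  ultimately show thesis
    by (intro that[of A]) (auto simp: A_def)
qed

text \<open>Quantiles coincide at heavy atoms, whereas the grid needs distinct coordinates. The
  sequence lists \<open>A\<close> first and then continues injectively in its complement; additional
  cut points only refine the cells.\<close>

lemma finite_subset_injective_prefix:
  fixes A :: "'a set"
  assumes "infinite (UNIV :: 'a set)" "finite A" "card A \<le> n"
  obtains a :: "nat \<Rightarrow> 'a" where "inj a" "A \<subseteq> a ` {..<n}"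
proof -
  obtain h where h: "bij_betw h {..<card A} A"
    using ex_bij_betw_nat_finite[OF assms(2)] by (auto simp: atLeast0LessThan)
  have "infinite (- A)"
    using assms by (simp add: Compl_eq_Diff_UNIV)
  then obtain g :: "nat \<Rightarrow> 'a" where g: "inj g" "range g \<subseteq> - A"
    using infinite_countable_subset by blast
  define a where "a i = (if i < card A then h i else g i)" for i
  have "inj a"
  proof (rule injI)
    fix i j assume eq: "a i = a j"
    have "h i \<in> A" if "i < card A" for i
      using h that by (auto simp: bij_betw_def)
    moreover have "g i \<notin> A" for i
      using g(2) by auto
    ultimately have "i < card A \<longleftrightarrow> j < card A"
      using eq by (metis a_def)
    then show "i = j"
      using eq h g(1) by (auto simp: a_def bij_betw_def inj_on_def split: if_splits)
  qed
  moreover have "A \<subseteq> a ` {..<n}"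
  proof
    fix x assume "x \<in> A"
    then obtain i where "i < card A" "x = h i"
      using h by (auto simp: bij_betw_def)
    then show "x \<in> a ` {..<n}"
      using assms(3) by (auto simp: a_def intro!: image_eqI[of _ _ i])
  qed
  ultimately show thesis by (rule that)
qed

section \<open>Labelling the line by its position among the cut points\<close>

text \<open>
  The nonempty fibers are the points \<open>a i\<close> and the open intervals between them, without
  any need to sort the \<open>a i\<close>.
\<close>

definition cut_rank :: "nat \<Rightarrow> (nat \<Rightarrow> real) \<Rightarrow> real \<Rightarrow> nat" where
  "cut_rank n a x = (\<Sum>i<n. of_bool (a i < x)) + (\<Sum>i<n. of_bool (a i \<le> x))"

lemma rank_le: "cut_rank n a x \<le> 2 * n"
proof -
  have "(\<Sum>i<n. of_bool (P i)) \<le> n" for P :: "nat \<Rightarrow> bool"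
    using sum_bounded_above[of "{..<n}" "\<lambda>i. of_bool (P i) :: nat" 1] by simp
  from add_mono[OF this this] show ?thesis
    unfolding cut_rank_def by (simp add: mult_2)
qed

lemma mono_rank: "mono (cut_rank n a)"
  unfolding cut_rank_def by (intro monoI add_mono sum_mono) auto

text \<open>Leaving a cut point raises the strict count and reaching one raises the weak
  count.\<close>

lemma rank_less:
  assumes "x < y" "x \<in> a ` {..<n} \<or> y \<in> a ` {..<n}"
  shows "cut_rank n a x < cut_rank n a y"
  using assms(2)
proof
  assume "x \<in> a ` {..<n}"
  then obtain i where "i < n" "a i = x" by auto
  then have "(\<Sum>i<n. of_bool (a i < x)) < (\<Sum>i<n. of_bool (a i < y) :: nat)"
    using assms(1) by (intro sum_strict_mono_ex1) (auto intro: bexI[of _ i])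
  moreover have "(\<Sum>i<n. of_bool (a i \<le> x)) \<le> (\<Sum>i<n. of_bool (a i \<le> y) :: nat)"
    using assms(1) by (intro sum_mono) auto
  ultimately show ?thesis unfolding cut_rank_def by linarith
next
  assume "y \<in> a ` {..<n}"
  then obtain i where "i < n" "a i = y" by auto
  then have "(\<Sum>i<n. of_bool (a i \<le> x)) < (\<Sum>i<n. of_bool (a i \<le> y) :: nat)"
    using assms(1) by (intro sum_strict_mono_ex1) (auto intro: bexI[of _ i])
  moreover have "(\<Sum>i<n. of_bool (a i < x)) \<le> (\<Sum>i<n. of_bool (a i < y) :: nat)"
    using assms(1) by (intro sum_mono) auto
  ultimately show ?thesis unfolding cut_rank_def by linarith
qed

text \<open>A fiber without cut points is an interval that avoids the quantiles, hence light; a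
  fiber with a cut point consists of that point alone.\<close>

lemma rank_fibers_small:
  assumes "real_distribution M" "0 < n"
  obtains a :: "nat \<Rightarrow> real" where "inj a"
    "\<And>s. measure M (cut_rank n a -` {s}) \<le> 1 / n \<or> (\<exists>c. cut_rank n a -` {s} \<subseteq> {c})"
proof -
  obtain A where A: "finite A" "card A \<le> n"
    "\<And>S. is_interval S \<Longrightarrow> S \<in> sets borel \<Longrightarrow> S \<inter> A = {} \<Longrightarrow> measure M S \<le> 1 / n"
    using quantile_cut_points[OF assms] by blast
  obtain a :: "nat \<Rightarrow> real" where a: "inj a" "A \<subseteq> a ` {..<n}"
    using finite_subset_injective_prefix[OF infinite_UNIV_char_0 A(1,2)] by blast
  have "measure M (cut_rank n a -` {s}) \<le> 1 / n \<or> (\<exists>c. cut_rank n a -` {s} \<subseteq> {c})" for s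
  proof (cases "cut_rank n a -` {s} \<inter> a ` {..<n} = {}")
    case True
    have "is_interval (cut_rank n a -` {s})"
      unfolding is_interval_1 by (auto intro!: antisym dest: monoD[OF mono_rank[of n a]])
    then show ?thesis
      using True a(2) mono_nat_fiber_borel[OF mono_rank[of n a]] by (intro disjI1 A(3)) auto
  next
    case False
    then obtain c where c: "cut_rank n a c = s" "c \<in> a ` {..<n}" by auto
    have "x = c" if "cut_rank n a x = s" for x
      using rank_less[of x c a n] rank_less[of c x a n] c that by (metis less_irrefl linorder_neqE)
    then show ?thesis by auto
  qed
  with a(1) show thesis by (rule that)
qed

section \<open>The defining formula\<close>

definition true_formula :: or_formula where
  "true_formula = Eq Zero Zero"

definition disj :: "or_formula list \<Rightarrow> or_formula" where
  "disj fs = foldr Or fs (Neg true_formula)"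

lemma sat_disj: "sat e (disj fs) \<longleftrightarrow> (\<exists>\<psi>\<in>set fs. sat e \<psi>)"
  by (induction fs) (auto simp: disj_def true_formula_def)

lemma free_vars_disj: "free_vars (disj fs) = (\<Union>\<psi>\<in>set fs. free_vars \<psi>)"
  by (induction fs) (auto simp: disj_def true_formula_def)

text \<open>Counting true formulas inside the logic makes ranks definable without quantifiers. The
  test \<open>c = 0\<close> guards the truncated \<open>c - 1\<close>: a true head already excludes
  the count zero.\<close>

primrec exactly :: "or_formula list \<Rightarrow> nat \<Rightarrow> or_formula" where
  "exactly [] c = (if c = 0 then true_formula else Neg true_formula)"
| "exactly (\<psi> # fs) c = Or (And (Neg \<psi>) (exactly fs c))
     (And \<psi> (if c = 0 then Neg true_formula else exactly fs (c - 1)))"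

lemma sat_exactly: "sat e (exactly fs c) \<longleftrightarrow> (\<Sum>\<psi>\<leftarrow>fs. of_bool (sat e \<psi>)) = c"
proof (induction fs arbitrary: c)
  case (Cons \<psi> fs)
  show ?case
    by (cases "sat e \<psi>"; cases c) (simp_all add: Cons.IH true_formula_def)
qed (simp add: true_formula_def)

lemma free_vars_exactly: "free_vars (exactly fs c) \<subseteq> (\<Union>\<psi>\<in>set fs. free_vars \<psi>)"
proof (induction fs arbitrary: c)
  case (Cons \<psi> fs)
  from Cons[of c] Cons[of "c - 1"] show ?case
    by (auto simp: true_formula_def)
qed (simp add: true_formula_def)

text \<open>Variable \<open>v\<close> holds the coordinate and the variables from \<open>k\<close>
  on hold the \<open>n\<close> cut points; a weak inequality is written as a negated strict
  one.\<close>

definition rank_formula :: "nat \<Rightarrow> nat \<Rightarrow> nat \<Rightarrow> nat \<Rightarrow> or_formula" where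
  "rank_formula n v k c = exactly
     (map (\<lambda>i. Less (Var (k + i)) (Var v)) [0..<n] @
      map (\<lambda>i. Neg (Less (Var v) (Var (k + i)))) [0..<n]) c"

lemma sat_rank_formula: "sat e (rank_formula n v k c) \<longleftrightarrow> cut_rank n (\<lambda>i. e (k + i)) (e v) = c"
proof -
  have "(\<Sum>i\<leftarrow>[0..<n]. of_bool (P i)) = (\<Sum>i<n. of_bool (P i) :: nat)" for P
    by (simp only: interv_sum_list_conv_sum_set_nat set_upt atLeast0LessThan)
  then show ?thesis
    by (simp only: rank_formula_def sat_exactly cut_rank_def map_append sum_list_append map_map
        comp_def sat.simps term_val.simps not_less)
qed

lemma free_vars_rank_formula: "free_vars (rank_formula n v k c) \<subseteq> insert v {k..<k + n}"
  unfolding rank_formula_def by (rule order_trans[OF free_vars_exactly]) auto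

text \<open>
  With \<open>n\<close> cut points an axis has \<open>2 * n + 1\<close> cells, so to have one bit
  per cell of the plane only the first \<open>n\<close> of the \<open>m = 2 * n + 1\<close> grid
  coordinates on each axis serve as cut points.
\<close>

definition grid_formula :: "nat \<Rightarrow> or_formula" where
  "grid_formula n = (let m = 2 * n + 1 in
     disj [And (And (rank_formula n 0 2 s) (rank_formula n 1 (2 + m) t))
        (Less Zero (Var (2 + 2 * m + (s * m + t)))). s \<leftarrow> [0..<m], t \<leftarrow> [0..<m]])"

lemma index_less_square:
  fixes s t m :: nat
  assumes "s < m" "t < m"
  shows "s * m + t < m\<^sup>2"
proof -
  have "s * m + t < Suc s * m" using assms by simp
  also have "\<dots> \<le> m * m" using assms by (intro mult_le_mono1) simp
  finally show ?thesis by (simp add: power2_eq_square)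
qed

lemma formula_in_grid_formula: "formula_in (2 * (2 * n + 1)) ((2 * n + 1)\<^sup>2) (grid_formula n)"
proof -
  define m where "m = 2 * n + 1"
  have "free_vars (rank_formula n 0 2 s) \<subseteq> {..<2 + 2 * m + m\<^sup>2}" for s
    by (rule order_trans[OF free_vars_rank_formula]) (auto simp: m_def)
  moreover have "free_vars (rank_formula n 1 (2 + m) s) \<subseteq> {..<2 + 2 * m + m\<^sup>2}" for s
    by (rule order_trans[OF free_vars_rank_formula]) (auto simp: m_def)
  moreover have "2 + 2 * m + (s * m + t) \<in> {..<2 + 2 * m + m\<^sup>2}" if "s < m" "t < m" for s t
    using index_less_square[OF that] by simp
  ultimately show ?thesis
    unfolding formula_in_def grid_formula_def Let_def free_vars_disj m_def[symmetric]
    by fastforce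
qed

lemma rank_cong: "(\<And>i. i < n \<Longrightarrow> a i = b i) \<Longrightarrow> cut_rank n a = cut_rank n b"
  by (simp add: cut_rank_def fun_eq_iff)

text \<open>Each point has exactly one pair of ranks, so only the disjunct of its own cell can hold,
  and this disjunct tests the bit stored for the cell in row-major order.\<close>

lemma defined_set_grid_formula:
  assumes m: "m = 2 * n + 1" and len: "length zs = 2 * m" "length ws = m\<^sup>2"
  shows "defined_set (grid_formula n) zs ws =
    {(x, y). 0 < ws ! (cut_rank n (\<lambda>i. zs ! i) x * m + cut_rank n (\<lambda>i. zs ! (m + i)) y)}"
proof -
  have "sat (\<lambda>i. if i < length (x # y # zs @ ws) then (x # y # zs @ ws) ! i else 0) (grid_formula n)
    \<longleftrightarrow> 0 < ws ! (cut_rank n (\<lambda>i. zs ! i) x * m + cut_rank n (\<lambda>i. zs ! (m + i)) y)" for x y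
  proof -
    define e where "e = (\<lambda>i. if i < length (x # y # zs @ ws) then (x # y # zs @ ws) ! i else 0)"
    have xy: "e 0 = x" "e 1 = y"
      by (simp_all add: e_def)
    \<comment> \<open>A rank reads only indices below \<open>n\<close>, where the environment agrees
      with the entries of \<open>zs\<close>.\<close>
    have "cut_rank n (\<lambda>i. e (2 + i)) = cut_rank n (\<lambda>i. zs ! i)"
      using m len by (intro rank_cong) (simp add: e_def nth_append)
    moreover have "cut_rank n (\<lambda>i. e (2 + m + i)) = cut_rank n (\<lambda>i. zs ! (m + i))"
      using m len by (intro rank_cong) (simp add: e_def nth_append)
    moreover have "e (2 + 2 * m + (s * m + t)) = ws ! (s * m + t)" if "s < m" "t < m" for s t
      using index_less_square[OF that] len by (simp add: e_def nth_append)
    moreover have "cut_rank n a z < m" for a z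
      using rank_le[of n a z] m by simp
    ultimately have "sat e (grid_formula n)
      \<longleftrightarrow> 0 < ws ! (cut_rank n (\<lambda>i. zs ! i) x * m + cut_rank n (\<lambda>i. zs ! (m + i)) y)"
      unfolding grid_formula_def Let_def sat_disj m[symmetric]
      using xy by (auto simp: sat_rank_formula)
    then show ?thesis unfolding e_def .
  qed
  then show ?thesis unfolding defined_set_def by simp
qed

text \<open>Labels are natural numbers, so the set is a countable union of products of Borel
  fibers.\<close>

lemma borel_mono_cells:
  fixes f g :: "real \<Rightarrow> nat"
  assumes "mono f" "mono g"
  shows "{(x, y). P (f x) (g y)} \<in> sets (borel :: (real \<times> real) measure)"
proof -
  have "{(x, y). P (f x) (g y)} = (\<Union>(s, t)\<in>{(s, t). P s t}. f -` {s} \<times> g -` {t})"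
    by auto
  also have "\<dots> \<in> sets (borel \<Otimes>\<^sub>M borel)"
    using mono_nat_fiber_borel[OF assms(1)] mono_nat_fiber_borel[OF assms(2)]
    by (intro sets.countable_UN'') auto
  finally show ?thesis unfolding borel_prod .
qed

text \<open>One formula serves both claims, and the grid version yields the other by taking the grid
  coordinates as \<open>zs\<close>. The Borel clause ensures that \<open>measure\<close> is applied
  to measurable sets, as it is 0 elsewhere.\<close>

theorem theorem4p1:
  fixes \<epsilon> :: real
  assumes "\<epsilon> > 0"
  shows "\<exists>k l \<phi>. formula_in k l \<phi> \<and>
    (\<forall>zs ws. length zs = k \<longrightarrow> length ws = l \<longrightarrow> defined_set \<phi> zs ws \<in> sets borel) \<and>
    (\<forall>\<mu>\<^sub>0 \<mu>\<^sub>1. real_distribution \<mu>\<^sub>0 \<longrightarrow> real_distribution \<mu>\<^sub>1 \<longrightarrow>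
      (\<forall>C\<in>convex_borel_sets. \<exists>zs ws. length zs = k \<and> length ws = l \<and>
        measure (\<mu>\<^sub>0 \<Otimes>\<^sub>M \<mu>\<^sub>1) (sym_diff (defined_set \<phi> zs ws) C) < \<epsilon>)) \<and>
    (\<exists>m. k = 2 * m \<and> l = m\<^sup>2 \<and>
      (\<forall>\<mu>\<^sub>0 \<mu>\<^sub>1. real_distribution \<mu>\<^sub>0 \<longrightarrow> real_distribution \<mu>\<^sub>1 \<longrightarrow>
        (\<exists>a b :: nat \<Rightarrow> real. inj_on a {..<m} \<and> inj_on b {..<m} \<and>
          (\<forall>C\<in>convex_borel_sets. \<exists>ws. length ws = l \<and> set ws \<subseteq> {0, 1} \<and>
            measure (\<mu>\<^sub>0 \<Otimes>\<^sub>M \<mu>\<^sub>1)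
              (sym_diff (defined_set \<phi> (map a [0..<m] @ map b [0..<m]) ws) C) < \<epsilon>))))"
proof -
  \<comment> \<open>With cells of mass at most \<open>1 / n\<close>, the error bound
    \<open>12 * (1 / n)\<close> is then strictly below \<open>\<epsilon>\<close>.\<close>
  obtain n where "12 / \<epsilon> < real n"
    using reals_Archimedean2 by blast
  then have n: "0 < n" "12 < real n * \<epsilon>"
    using assms by (auto simp: pos_divide_less_eq intro!: gr0I)
  then have \<delta>: "12 * (1 / real n) < \<epsilon>"
    by (simp add: pos_divide_less_eq mult.commute)
  define m where "m = 2 * n + 1"
  let ?\<phi> = "grid_formula n"
  have rank_m: "cut_rank n a x < m" for a x
    using rank_le[of n a x] by (simp add: m_def)
  have grid: "\<exists>a b :: nat \<Rightarrow> real. inj_on a {..<m} \<and> inj_on b {..<m} \<and>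
      (\<forall>C\<in>convex_borel_sets. \<exists>ws. length ws = m\<^sup>2 \<and> set ws \<subseteq> {0, 1} \<and>
        measure (\<mu> \<Otimes>\<^sub>M \<nu>)
          (sym_diff (defined_set ?\<phi> (map a [0..<m] @ map b [0..<m]) ws) C) < \<epsilon>)"
    if \<mu>: "real_distribution \<mu>" and \<nu>: "real_distribution \<nu>" for \<mu> \<nu>
  proof -
    obtain a :: "nat \<Rightarrow> real" where a: "inj a"
      "\<And>s. measure \<mu> (cut_rank n a -` {s}) \<le> 1 / n \<or> (\<exists>c. cut_rank n a -` {s} \<subseteq> {c})"
      using rank_fibers_small[OF \<mu> n(1)] by blast
    obtain b :: "nat \<Rightarrow> real" where b: "inj b"
      "\<And>s. measure \<nu> (cut_rank n b -` {s}) \<le> 1 / n \<or> (\<exists>c. cut_rank n b -` {s} \<subseteq> {c})"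
      using rank_fibers_small[OF \<nu> n(1)] by blast
    have "\<exists>ws. length ws = m\<^sup>2 \<and> set ws \<subseteq> {0, 1} \<and> measure (\<mu> \<Otimes>\<^sub>M \<nu>)
        (sym_diff (defined_set ?\<phi> (map a [0..<m] @ map b [0..<m]) ws) C) < \<epsilon>"
      if "C \<in> convex_borel_sets" for C
    proof -
      \<comment> \<open>Position \<open>i\<close> encodes the cell with labels
        \<open>i div m\<close> and \<open>i mod m\<close>. Empty cells get the bit 1, which is
        harmless because no point has their labels.\<close>
      define ws :: "real list" where
        "ws = map (\<lambda>i. of_bool (cut_rank n a -` {i div m} \<times> cut_rank n b -` {i mod m} \<subseteq> C)) [0..<m\<^sup>2]"
      have ws: "0 < ws ! (s * m + t) \<longleftrightarrow> cut_rank n a -` {s} \<times> cut_rank n b -` {t} \<subseteq> C"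
        if "s < m" "t < m" for s t
        using index_less_square[OF that] that by (simp add: ws_def)
      have a_eq: "cut_rank n (\<lambda>i. (map a [0..<m] @ map b [0..<m]) ! i) = cut_rank n a"
        by (rule rank_cong) (simp add: m_def nth_append)
      have b_eq: "cut_rank n (\<lambda>i. (map a [0..<m] @ map b [0..<m]) ! (m + i)) = cut_rank n b"
        by (rule rank_cong) (simp add: m_def nth_append)
      have "defined_set ?\<phi> (map a [0..<m] @ map b [0..<m]) ws =
          {(x, y). cut_rank n a -` {cut_rank n a x} \<times> cut_rank n b -` {cut_rank n b y} \<subseteq> C}"
        using defined_set_grid_formula[OF m_def, of "map a [0..<m] @ map b [0..<m]" ws]
        unfolding a_eq b_eq by (simp add: ws rank_m) (simp add: ws_def)
      moreover have "measure (\<mu> \<Otimes>\<^sub>M \<nu>)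
          (sym_diff {(x, y). cut_rank n a -` {cut_rank n a x} \<times> cut_rank n b -` {cut_rank n b y} \<subseteq> C} C) \<le> 12 * (1 / real n)"
        using that \<mu> \<nu> a b rank_m
        by (intro convex_cell_approximation[where m = m])
          (auto simp: convex_borel_sets_def mono_rank)
      moreover have "length ws = m\<^sup>2" "set ws \<subseteq> {0, 1}"
        by (auto simp: ws_def)
      ultimately show ?thesis
        using \<delta> by (intro exI[of _ ws]) auto
    qed
    \<comment> \<open>The sequences are injective on all of \<open>nat\<close>, so the coordinates
      beyond the first \<open>n\<close> are distinct as well.\<close>
    then show ?thesis
      using a(1) b(1) by (meson inj_on_subset subset_UNIV)
  qed
  have any: "\<exists>zs ws. length zs = 2 * m \<and> length ws = m\<^sup>2 \<and>
      measure (\<mu> \<Otimes>\<^sub>M \<nu>) (sym_diff (defined_set ?\<phi> zs ws) C) < \<epsilon>"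
    if dist: "real_distribution \<mu>" "real_distribution \<nu>" and C: "C \<in> convex_borel_sets" for \<mu> \<nu> C
  proof -
    obtain a b :: "nat \<Rightarrow> real" and ws where "length ws = m\<^sup>2"
      "measure (\<mu> \<Otimes>\<^sub>M \<nu>)
        (sym_diff (defined_set ?\<phi> (map a [0..<m] @ map b [0..<m]) ws) C) < \<epsilon>"
      using grid[OF dist] C by blast
    then show ?thesis
      by (intro exI[of _ "map a [0..<m] @ map b [0..<m]"] exI[of _ ws]) simp
  qed
  have borel: "defined_set ?\<phi> zs ws \<in> sets borel" if "length zs = 2 * m" "length ws = m\<^sup>2" for zs ws
    unfolding defined_set_grid_formula[OF m_def that] by (intro borel_mono_cells mono_rank)
  have \<phi>: "formula_in (2 * m) (m\<^sup>2) ?\<phi>"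
    using formula_in_grid_formula by (simp only: m_def)
  show ?thesis
    by (rule exI[of _ "2 * m"], rule exI[of _ "m\<^sup>2"], rule exI[of _ ?\<phi>])
      (intro conjI allI impI ballI exI[of _ m] refl \<phi> borel any grid; assumption)
qed

end
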